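(* Let $q=p^n$, $p$ prime, and let $\mathcal S$ be a mod $p$ generalized KM-arc of type $(0,m,t)_p$ in $\mathrm{PG}(2,q)$ with $t\neq m$, and assume that the proper $t_p$-secants of $\mathcal S$ are not concurrent. Let $t'$ and $m'$ be the least number of points of $\mathcal S$ on a proper $t_p$-secant and on a proper $m_p$-secant, respectively. Then the number of proper $t_p$-secants through any point $P\notin\mathcal S$ is at most $(q-1)/t'$. Hence the number of points of $\mathcal S$ on an $m_p$-secant is also at most $(q-1)/t'$.
   Context: For a point set $\mathcal S$, an $i_p$-secant ($0\le i\le p-1$) is a line meeting $\mathcal S$ in a number of points congruent to $i\pmod p$; it is proper if it meets $\mathcal S$ in at least one point. A mod $p$ generalized KM-arc of type $(0,m,t)_p$ in a projective plane of order $q=p^n$ is a proper non-empty point set $\mathcal S$ such that every point $R\in\mathcal S$ is incident with a $t_p$-secant and the other $q$ lines through $R$ are $m_p$-secants, where $0\le m,t\le p-1$. *)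

theory Defs
  imports "HOL-Analysis.Cartesian_Space" "HOL-Number_Theory.Cong"
begin

text \<open>
  The Desarguesian plane over a field: points are the one-dimensional subspaces of the
  three-dimensional coordinate space; a line is the set of all points contained in a
  two-dimensional subspace. For a field with \<open>q\<close> elements this is \<open>PG(2,q)\<close>.
\<close>

definition pg2_points :: "(('a::field) ^ 3) set set" where
  "pg2_points = {P. vec.subspace P \<and> vec.dim P = 1}"

definition pg2_lines :: "(('a::field) ^ 3) set set set" where
  "pg2_lines = {{P \<in> pg2_points. P \<subseteq> W} | W. vec.subspace W \<and> vec.dim W = 2}"

text \<open>
  The following notions are stated for a plane given by its set of points and its set of lines,
  each line being a set of points.
\<close>

definition concurrent :: "'p set \<Rightarrow> 'p set set \<Rightarrow> bool" where
  "concurrent Pts Ls \<longleftrightarrow> (\<exists>P\<in>Pts. \<forall>l\<in>Ls. P \<in> l)"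

definition mod_secants :: "'p set set \<Rightarrow> 'p set \<Rightarrow> nat \<Rightarrow> nat \<Rightarrow> 'p set set" where
  "mod_secants Lns S p i = {l \<in> Lns. [card (l \<inter> S) = i] (mod p)}"

definition proper_mod_secants :: "'p set set \<Rightarrow> 'p set \<Rightarrow> nat \<Rightarrow> nat \<Rightarrow> 'p set set" where
  "proper_mod_secants Lns S p i = {l \<in> mod_secants Lns S p i. l \<inter> S \<noteq> {}}"

text \<open>
  In a plane of order \<open>q\<close> there are exactly \<open>q\<close> lines through \<open>R\<close> other than \<open>l\<close>, so the
  last clause speaks about "the other \<open>q\<close> lines".
\<close>

definition mod_generalized_KM_arc ::
    "'p set \<Rightarrow> 'p set set \<Rightarrow> nat \<Rightarrow> nat \<Rightarrow> nat \<Rightarrow> 'p set \<Rightarrow> bool" where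
  "mod_generalized_KM_arc Pts Lns p m t S \<longleftrightarrow>
     m \<le> p - 1 \<and> t \<le> p - 1 \<and> S \<subset> Pts \<and> S \<noteq> {} \<and>
     (\<forall>R\<in>S. \<exists>l\<in>mod_secants Lns S p t. R \<in> l \<and>
        (\<forall>l'\<in>Lns. R \<in> l' \<and> l' \<noteq> l \<longrightarrow> l' \<in> mod_secants Lns S p m))"

end

theory Submission
  imports Defs "HOL-Number_Theory.Residues"
begin

text \<open>
  Let \<open>g\<close> be an \<open>m\<^sub>p\<close>-secant, viewed as the line at infinity. For \<open>R \<in> g \<inter> S\<close>
  all affine lines through \<open>R\<close> but one contain \<open>m - 1\<close> affine points of \<open>S\<close> modulo \<open>p\<close>.
  Summing the affine points of \<open>S\<close> along this parallel class shows that the exceptional line,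
  the \<open>t\<^sub>p\<close>-secant at \<open>R\<close>, passes through their centroid, because the elements of a field
  with more than two elements sum to zero and the number of affine points is
  \<open>t - m \<noteq> 0\<close> modulo \<open>p\<close>. So the \<open>t\<^sub>p\<close>-secants at the points of \<open>g \<inter> S\<close> concur.
  For \<open>q = 2\<close> this still holds when \<open>g\<close> has three points in \<open>S\<close>, since then \<open>m - 1 = 0\<close> modulo \<open>p\<close>.

  Now let \<open>P \<notin> S\<close>, let \<open>h\<close> be a proper \<open>t\<^sub>p\<close>-secant missing \<open>P\<close>, and \<open>R \<in> h \<inter> S\<close>. A line
  through \<open>R\<close> that contained two points of \<open>S\<close> lying on \<open>t\<^sub>p\<close>-secants through \<open>P\<close> would force
  \<open>P \<in> h\<close>; hence each of the \<open>q - 1\<close> lines through \<open>R\<close> other than \<open>h\<close> and \<open>RP\<close> contains at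
  most one such point, and \<open>h\<close> and \<open>RP\<close> contain none. For an \<open>m\<^sub>p\<close>-secant, apply this bound
  to a common point of the \<open>t\<^sub>p\<close>-secants at its points in \<open>S\<close>.
\<close>

section \<open>Linear algebra in three-dimensional coordinate space: orthogonality and
  planes\<close>

text \<open>Only a bilinear form: over a finite field a nonzero vector can be orthogonal to itself,
  so complements are handled by dimension counts.\<close>

definition dot :: "'a::field ^ 'n \<Rightarrow> 'a ^ 'n \<Rightarrow> 'a" where
  "dot a x = (\<Sum>i\<in>UNIV. a $ i * x $ i)"

lemma dot_simps [simp]:
  "dot 0 x = 0" "dot a 0 = 0"
  "dot (a + b) x = dot a x + dot b x" "dot (a - b) x = dot a x - dot b x"
  "dot (c *s a) x = c * dot a x"
  "dot a (x + y) = dot a x + dot a y" "dot a (c *s x) = c * dot a x"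
  by (simp_all add: dot_def algebra_simps sum.distrib sum_subtractf sum_distrib_left)

lemma dot_commute: "dot a x = dot x a"
  by (simp add: dot_def mult.commute)

lemma dot_sum: "dot a (\<Sum>i\<in>I. f i) = (\<Sum>i\<in>I. dot a (f i))"
  by (induction I rule: infinite_finite_induct) auto

lemma dot_axis: "dot a (axis i 1) = a $ i"
  by (simp add: dot_def axis_def if_distrib cong: if_cong)

lemma dot_nonzero_ex: "a \<noteq> 0 \<Longrightarrow> \<exists>x. dot a x \<noteq> 0"
  by (metis dot_axis vec_eq_iff zero_index)

text \<open>The square matrix with rows \<open>u\<close>, \<open>v\<close>, 0 has no right inverse,
  hence a nontrivial kernel. By duality this yields both the join of two points and the meet of two
  lines.\<close>

lemma common_orthogonal_vector:
  fixes u v :: "'a::field ^ 3"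
  shows "\<exists>w. w \<noteq> 0 \<and> dot u w = 0 \<and> dot v w = 0"
proof (rule ccontr)
  define A :: "'a ^ 3 ^ 3" where "A = (\<chi> i. if i = 1 then u else if i = 2 then v else 0)"
  have A: "(A *v w) $ i = dot (A $ i) w" for w i
    by (simp add: matrix_vector_mult_def dot_def)
  assume "\<not> ?thesis"
  then have *: "dot u w = 0 \<Longrightarrow> dot v w = 0 \<Longrightarrow> w = 0" for w
    by blast
  have "w = 0" if "A *v w = 0" for w
  proof (rule *)
    show "dot u w = 0" using that A[of w 1] by (simp add: A_def)
    show "dot v w = 0" using that A[of w 2] by (simp add: A_def)
  qed
  then obtain B where "A ** B = mat 1"
    using matrix_left_invertible_ker matrix_left_right_inverse by metis
  then have "(A ** B) $ 3 $ 3 = 1" by (simp add: mat_def)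
  moreover have "(A ** B) $ 3 $ 3 = 0" by (simp add: matrix_matrix_mult_def A_def)
  ultimately show False by simp
qed

lemma subspace_orthogonal: "vec.subspace {x. dot a x = 0}"
  by (simp add: vec.subspace_def)

lemma dim_span_pair:
  assumes "x \<noteq> 0" "y \<notin> vec.span {x}"
  shows "vec.dim (vec.span {x, y}) = 2"
proof -
  have "vec.independent {y, x}"
    using assms by (simp add: vec.independent_insert)
  moreover have "x \<noteq> y" using assms(2) vec.span_base by blast
  ultimately show ?thesis
    by (simp add: vec.dim_eq_card_independent insert_commute)
qed

lemma plane_eq_span_pair:
  assumes "vec.subspace W" "vec.dim W = 2" "x \<in> W" "y \<in> W" "x \<noteq> 0" "y \<notin> vec.span {x}"
  shows "W = vec.span {x, y}"
proof -
  have "vec.span {x, y} \<subseteq> W"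
    using assms by (intro vec.span_minimal) auto
  then show ?thesis
    using assms dim_span_pair[OF assms(5,6)] vec.subspace_dim_equal[of "vec.span {x,y}" W] by simp
qed

lemma dim_orthogonal:
  fixes a :: "'a::field ^ 3"
  assumes "a \<noteq> 0"
  shows "vec.dim {x. dot a x = 0} = 2"
proof (rule antisym)
  obtain z where "dot a z \<noteq> 0" using dot_nonzero_ex[OF assms] by blast
  then have "{x. dot a x = 0} \<noteq> UNIV" by blast
  then have "\<not> 3 \<le> vec.dim {x. dot a x = 0}"
    using vec.subspace_dim_equal[OF subspace_orthogonal vec.subspace_UNIV subset_UNIV, of a]
      vec_dim_card[where 'a = 'a and 'n = 3] by auto
  then show "vec.dim {x. dot a x = 0} \<le> 2" by simp
next
  obtain u where u: "u \<noteq> 0" "dot a u = 0" using common_orthogonal_vector by blast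
  \<comment> \<open>\<open>e\<close> serves to separate \<open>v\<close> from the multiples of
    \<open>u\<close>; the choice \<open>e = u\<close> could fail because \<open>dot u u\<close> may
    vanish.\<close>
  obtain e where e: "dot e u \<noteq> 0" using dot_nonzero_ex[OF u(1)] dot_commute by metis
  obtain v where v: "v \<noteq> 0" "dot a v = 0" "dot e v = 0" using common_orthogonal_vector by blast
  have "v \<notin> vec.span {u}"
    using v e by (auto simp: vec.span_singleton)
  then have "vec.dim (vec.span {u, v}) = 2" using u by (intro dim_span_pair)
  moreover have "vec.span {u, v} \<subseteq> {x. dot a x = 0}"
    using u v by (intro vec.span_minimal subspace_orthogonal) auto
  ultimately show "2 \<le> vec.dim {x. dot a x = 0}"
    by (metis vec.dim_subset)
qed

text \<open>A nonzero vector orthogonal to a basis of \<open>W\<close> has a complement that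
  contains \<open>W\<close> and has the same dimension.\<close>

lemma plane_eq_orthogonal:
  fixes W :: "('a::field ^ 3) set"
  assumes "vec.subspace W" "vec.dim W = 2"
  shows "\<exists>a. a \<noteq> 0 \<and> W = {x. dot a x = 0}"
proof -
  obtain B where B: "B \<subseteq> W" "vec.independent B" "W \<subseteq> vec.span B" "card B = 2"
    using vec.basis_exists[of W] assms(2) by metis
  then obtain u v where uv: "B = {u, v}" by (meson card_2_iff)
  obtain a where a: "a \<noteq> 0" "dot u a = 0" "dot v a = 0" using common_orthogonal_vector by blast
  have "vec.span B \<subseteq> {x. dot a x = 0}"
    using uv a by (intro vec.span_minimal subspace_orthogonal) (auto simp: dot_commute)
  with B have "W \<subseteq> {x. dot a x = 0}" by blast
  then have "W = {x. dot a x = 0}"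
    using assms dim_orthogonal[OF a(1)]
    by (intro vec.subspace_dim_equal) (auto simp: subspace_orthogonal)
  with a show ?thesis by blast
qed

section \<open>Lines of the plane in homogeneous coordinates, incidence and pencils\<close>

text \<open>The homogeneous coordinates of a line. The zero vector would give the set of all points
  and must be excluded.\<close>

definition pg2_line :: "'a::field ^ 3 \<Rightarrow> ('a ^ 3) set set" where
  "pg2_line a = {P \<in> pg2_points. P \<subseteq> {x. dot a x = 0}}"

lemma pg2_lines_eq: "pg2_lines = pg2_line ` (- {0 :: 'a::field ^ 3})"
proof
  show "pg2_lines \<subseteq> pg2_line ` (- {0 :: 'a ^ 3})"
  proof
    fix l :: "('a ^ 3) set set"
    assume "l \<in> pg2_lines"
    then obtain W where "vec.subspace W" "vec.dim W = 2" "l = {P \<in> pg2_points. P \<subseteq> W}"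
      by (auto simp: pg2_lines_def)
    then show "l \<in> pg2_line ` (- {0})"
      using plane_eq_orthogonal[of W] by (auto simp: pg2_line_def)
  qed
  show "pg2_line ` (- {0 :: 'a ^ 3}) \<subseteq> pg2_lines"
  proof
    fix l :: "('a ^ 3) set set"
    assume "l \<in> pg2_line ` (- {0})"
    then obtain a where "a \<noteq> 0" "l = pg2_line a" by blast
    then show "l \<in> pg2_lines"
      unfolding pg2_lines_def pg2_line_def
      using subspace_orthogonal[of a] dim_orthogonal[of a] by blast
  qed
qed

lemma pg2_points_eq: "pg2_points = (\<lambda>x. vec.span {x}) ` (- {0 :: 'a::field ^ 3})"
proof
  show "(\<lambda>x. vec.span {x}) ` (- {0 :: 'a ^ 3}) \<subseteq> pg2_points"
    by (auto simp: pg2_points_def vec.dim_eq_card_independent vec.independent_insert)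
  show "pg2_points \<subseteq> (\<lambda>x. vec.span {x}) ` (- {0 :: 'a ^ 3})"
  proof
    fix P :: "('a ^ 3) set"
    assume P: "P \<in> pg2_points"
    then have sub: "vec.subspace P" "vec.dim P = 1" by (auto simp: pg2_points_def)
    obtain B where B: "B \<subseteq> P" "vec.independent B" "P \<subseteq> vec.span B" "card B = 1"
      using vec.basis_exists[of P] sub(2) by metis
    then obtain x where x: "B = {x}" by (meson card_1_singletonE)
    have "x \<noteq> 0" using B(2) x vec.dependent_zero by blast
    moreover have "P = vec.span {x}"
      using B x sub vec.span_minimal by blast
    ultimately show "P \<in> (\<lambda>x. vec.span {x}) ` (- {0 :: 'a ^ 3})" by blast
  qed
qed

lemma span_in_pg2_points: "x \<noteq> 0 \<Longrightarrow> vec.span {x} \<in> pg2_points" for x :: "'a::field ^ 3"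
  by (auto simp: pg2_points_eq)

lemma span_in_pg2_line:
  fixes x :: "'a::field ^ 3"
  assumes x: "x \<noteq> 0"
  shows "vec.span {x} \<in> pg2_line a \<longleftrightarrow> dot a x = 0"
proof -
  have "vec.span {x} \<subseteq> {x. dot a x = 0} \<longleftrightarrow> dot a x = 0"
    using vec.span_minimal[OF _ subspace_orthogonal, of "{x}" a] vec.span_base[of x "{x}"] by blast
  with span_in_pg2_points[OF x] show ?thesis
    by (simp add: pg2_line_def)
qed

lemma pg2_line_join:
  fixes P :: "('a::field ^ 3) set"
  assumes "P \<in> pg2_points" "Q \<in> pg2_points"
  shows "\<exists>l\<in>pg2_lines. P \<in> l \<and> Q \<in> l"
proof -
  obtain x y where "x \<noteq> 0" "P = vec.span {x}" "y \<noteq> 0" "Q = vec.span {y}"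
    using assms by (auto simp: pg2_points_eq)
  moreover obtain a where "a \<noteq> 0" "dot x a = 0" "dot y a = 0"
    using common_orthogonal_vector by blast
  ultimately show ?thesis
    by (auto simp: pg2_lines_eq span_in_pg2_line dot_commute intro!: bexI[of _ a])
qed

lemma pg2_lines_meet:
  fixes l :: "('a::field ^ 3) set set"
  assumes "l \<in> pg2_lines" "k \<in> pg2_lines"
  shows "\<exists>P\<in>pg2_points. P \<in> l \<and> P \<in> k"
proof -
  obtain a b where "l = pg2_line a" "k = pg2_line b"
    using assms by (auto simp: pg2_lines_eq)
  moreover obtain x where "x \<noteq> 0" "dot a x = 0" "dot b x = 0"
    using common_orthogonal_vector by blast
  ultimately show ?thesis
    using span_in_pg2_line span_in_pg2_points by blast
qed

lemma pg2_points_eqI: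
  assumes "P \<in> pg2_points" "Q \<in> pg2_points" "x \<in> P" "x \<in> Q" "x \<noteq> 0"
  shows "P = Q"
proof -
  have "R = vec.span {x}" if R: "R \<in> pg2_points" "x \<in> R" for R
  proof -
    have "vec.span {x} \<subseteq> R"
      using R by (intro vec.span_minimal) (auto simp: pg2_points_def)
    moreover have "vec.dim (vec.span {x}) = 1" "vec.dim R = 1" "vec.subspace R"
      using R span_in_pg2_points[OF assms(5)] by (auto simp: pg2_points_def)
    ultimately show ?thesis
      using vec.subspace_dim_equal[of "vec.span {x}" R] by simp
  qed
  then show ?thesis using assms by metis
qed

text \<open>Vectors representing \<open>P\<close> and \<open>Q\<close> are independent, so each of
  the two underlying planes is their span.\<close>

lemma pg2_line_unique:
  fixes l :: "('a::field ^ 3) set set"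
  assumes "l \<in> pg2_lines" "k \<in> pg2_lines" "P \<noteq> Q" "P \<in> l" "Q \<in> l" "P \<in> k" "Q \<in> k"
  shows "l = k"
proof -
  obtain V W where V: "vec.subspace V" "vec.dim V = 2" "l = {P \<in> pg2_points. P \<subseteq> V}"
    and W: "vec.subspace W" "vec.dim W = 2" "k = {P \<in> pg2_points. P \<subseteq> W}"
    using assms(1,2) by (auto simp: pg2_lines_def)
  have PQ: "P \<in> pg2_points" "Q \<in> pg2_points" using assms V by auto
  then obtain x y where x: "x \<noteq> 0" "P = vec.span {x}" and y: "y \<noteq> 0" "Q = vec.span {y}"
    by (auto simp: pg2_points_eq)
  have "y \<notin> vec.span {x}"
    using pg2_points_eqI[OF PQ, of y] x y assms(3) vec.span_base by blast
  moreover have "x \<in> V" "y \<in> V" "x \<in> W" "y \<in> W"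
    using assms V W x y vec.span_base by blast+
  ultimately have "V = vec.span {x, y}" "W = vec.span {x, y}"
    using plane_eq_span_pair[of V x y] plane_eq_span_pair[of W x y] V W x(1) by auto
  then show ?thesis using V W by simp
qed

lemma pg2_line_scale: "c \<noteq> 0 \<Longrightarrow> pg2_line (c *s a) = pg2_line a"
  by (simp add: pg2_line_def)

text \<open>With \<open>pg2_line a\<close> at infinity, \<open>c\<close> parametrizes the affine
  lines of the pencil spanned by \<open>a\<close> and \<open>b\<close>. If \<open>b - c *s a\<close>
  had the same zeros as \<open>a\<close>, then \<open>b\<close> would vanish on them too, and both
  lines would coincide by dimension.\<close>

lemma pg2_pencil_in:
  fixes a b :: "'a::field ^ 3"
  assumes "a \<noteq> 0" "b \<noteq> 0" "pg2_line a \<noteq> pg2_line b"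
  shows "pg2_line (b - c *s a) \<in> pg2_lines" "pg2_line (b - c *s a) \<noteq> pg2_line a"
proof -
  have "b - c *s a \<noteq> 0"
  proof
    assume "b - c *s a = 0"
    then have "b = c *s a" by simp
    moreover from this have "c \<noteq> 0" using assms(2) by auto
    ultimately show False using assms(3) pg2_line_scale by metis
  qed
  then show "pg2_line (b - c *s a) \<in> pg2_lines" by (auto simp: pg2_lines_eq)
  show "pg2_line (b - c *s a) \<noteq> pg2_line a"
  proof
    assume eq: "pg2_line (b - c *s a) = pg2_line a"
    have "P \<in> pg2_line b" if P: "P \<in> pg2_line a" for P
    proof -
      obtain x where x: "x \<noteq> 0" "P = vec.span {x}"
        using P by (auto simp: pg2_line_def pg2_points_eq)
      then show ?thesis using P eq span_in_pg2_line[OF x(1), of a]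
          span_in_pg2_line[OF x(1), of b] span_in_pg2_line[OF x(1), of "b - c *s a"] by simp
    qed
    then have sub: "pg2_line a \<subseteq> pg2_line b" by blast
    have sub': "{x. dot a x = 0} \<subseteq> {x. dot b x = 0}"
    proof (intro subsetI CollectI)
      fix x assume x: "x \<in> {x. dot a x = 0}"
      show "dot b x = 0"
        using sub span_in_pg2_line[of x a] span_in_pg2_line[of x b] x by (cases "x = 0") auto
    qed
    have "{x. dot a x = 0} = {x. dot b x = 0}"
      using dim_orthogonal[OF assms(1)] dim_orthogonal[OF assms(2)]
      by (intro vec.subspace_dim_equal subspace_orthogonal sub') simp
    then show False using assms(3) by (simp add: pg2_line_def)
  qed
qed

lemma pg2_pencil_mem:
  assumes "R \<in> pg2_line a" "R \<in> pg2_line b"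
  shows "R \<in> pg2_line (b - c *s a)"
proof -
  have "dot (b - c *s a) x = 0" if "x \<in> R" for x
  proof -
    have "dot a x = 0" "dot b x = 0" using assms that unfolding pg2_line_def by blast+
    then show ?thesis by simp
  qed
  then show ?thesis using assms(1) unfolding pg2_line_def by blast
qed

section \<open>Finite fields: characteristic, sum of all elements, and size of a line\<close>

lemma CHAR_finite_field:
  assumes "prime p" "CARD('a::{field,finite}) = p ^ n"
  shows "CHAR('a) = p"
proof -
  have "CHAR('a) dvd p ^ n" using CHAR_dvd_CARD[where 'a = 'a] assms(2) by simp
  moreover have "prime CHAR('a)"
    using finite_imp_CHAR_pos[where 'a = 'a] prime_CHAR_semidom[where 'a = 'a] by simp
  ultimately show ?thesis
    using assms(1) prime_dvd_power primes_dvd_imp_eq by blast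
qed

lemma of_nat_CARD_eq_0: "of_nat CARD('a::{field,finite}) = (0 :: 'a)"
  using CHAR_dvd_CARD[where 'a = 'a] by (simp add: of_nat_eq_0_iff_char_dvd)

text \<open>Multiplication by some \<open>a\<close> other than 0 and 1 permutes the field, so it
  fixes the sum. In the field of order two the sum is 1.\<close>

lemma sum_finite_field:
  assumes "CARD('a::{field,finite}) \<noteq> 2"
  shows "(\<Sum>x\<in>(UNIV :: 'a set). x) = 0"
proof -
  have "UNIV \<noteq> {0, 1 :: 'a}"
  proof
    assume *: "UNIV = {0, 1 :: 'a}"
    have "CARD('a) = card {0, 1 :: 'a}" by (simp only: *)
    then show False using assms by simp
  qed
  then obtain a :: 'a where a: "a \<noteq> 0" "a \<noteq> 1" by blast
  have "bij ((*) a)"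
    using a by (intro bijI injI surjI[of _ "\<lambda>y. y / a"]) auto
  then have "(\<Sum>x\<in>UNIV. a * x) = (\<Sum>x\<in>UNIV. x)"
    by (rule sum.reindex_bij_betw)
  then have "a * (\<Sum>x\<in>UNIV. x) = (\<Sum>x\<in>UNIV. x)"
    by (simp only: sum_distrib_left)
  with a show ?thesis by simp
qed

text \<open>A vector \<open>s *s x + u *s y\<close> of the plane represents \<open>P\<close> if
  \<open>u = 0\<close>, and otherwise scales to \<open>y + c *s x\<close>. The bound serves the case
  of order two, where the field elements do not sum to zero.\<close>

lemma card_pg2_line_le:
  fixes l :: "('a::{field,finite} ^ 3) set set"
  assumes "l \<in> pg2_lines"
  shows "card l \<le> CARD('a) + 1"
proof (cases "\<exists>P Q. P \<in> l \<and> Q \<in> l \<and> P \<noteq> Q")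
  case True
  then obtain P Q where PQ: "P \<in> l" "Q \<in> l" "P \<noteq> Q" by blast
  obtain W where W: "vec.subspace W" "vec.dim W = 2" "l = {P \<in> pg2_points. P \<subseteq> W}"
    using assms by (auto simp: pg2_lines_def)
  have pts: "P \<in> pg2_points" "Q \<in> pg2_points" using PQ W by auto
  then obtain x y where x: "x \<noteq> 0" "P = vec.span {x}" and y: "y \<noteq> 0" "Q = vec.span {y}"
    by (auto simp: pg2_points_eq)
  have "y \<notin> vec.span {x}"
    using pg2_points_eqI[OF pts, of y] x y PQ(3) vec.span_base by blast
  moreover have "x \<in> W" "y \<in> W" using PQ W x y vec.span_base by blast+
  ultimately have W_eq: "W = vec.span {x, y}"
    using plane_eq_span_pair[of W x y] W x(1) by simp
  have "l \<subseteq> insert P (range (\<lambda>c. vec.span {y + c *s x}))"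
  proof
    fix X assume X: "X \<in> l"
    then have Xpt: "X \<in> pg2_points" using W by simp
    then obtain z where z: "z \<noteq> 0" "X = vec.span {z}" by (auto simp: pg2_points_eq)
    have zX: "z \<in> X" using z vec.span_base by blast
    have "z \<in> vec.span {x, y}" using X W zX W_eq by blast
    then obtain s where "z - s *s x \<in> vec.span {y}" using vec.span_insert by blast
    then obtain u where "z - s *s x = u *s y" by (auto simp: vec.span_singleton)
    then have zeq: "z = s *s x + u *s y" by (simp add: algebra_simps)
    show "X \<in> insert P (range (\<lambda>c. vec.span {y + c *s x}))"
    proof (cases "u = 0")
      case True
      then have "z \<in> P" using zeq x(2) vec.span_scale[OF vec.span_base, of x "{x}" s] by simp
      then show ?thesis using pg2_points_eqI[OF Xpt pts(1) zX _ z(1)] by blast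
    next
      case False
      then have w: "z = u *s (y + (s / u) *s x)"
        using zeq by (simp add: vec_eq_iff field_simps)
      then have "y + (s / u) *s x \<noteq> 0" using z(1) by auto
      moreover have "z \<in> vec.span {y + (s / u) *s x}"
        by (subst w) (intro vec.span_scale vec.span_base, simp)
      ultimately have "X = vec.span {y + (s / u) *s x}"
        using pg2_points_eqI[OF Xpt span_in_pg2_points zX _ z(1)] by blast
      then show ?thesis by blast
    qed
  qed
  then have "card l \<le> card (insert P (range (\<lambda>c. vec.span {y + c *s x})))"
    by (intro card_mono) auto
  also have "\<dots> \<le> Suc (card (range (\<lambda>c. vec.span {y + c *s x})))"
    by (rule card_insert_le_m1) auto
  also have "\<dots> \<le> Suc CARD('a)"
    using card_image_le[of UNIV "\<lambda>c. vec.span {y + c *s x}"] by simp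
  finally show ?thesis by simp
next
  case False
  then have "card l \<le> Suc 0" by (metis card_le_Suc0_iff_eq finite)
  then show ?thesis by simp
qed

section \<open>Affine coordinates and sums over a parallel class\<close>

text \<open>
  Affine coordinates of a point \<open>Q\<close> with \<open>pg2_line a\<close> as the line at infinity;
  meaningless if \<open>Q\<close> lies on that line.
\<close>

definition affine_vector :: "'a::field ^ 3 \<Rightarrow> ('a ^ 3) set \<Rightarrow> 'a ^ 3" where
  "affine_vector a Q = (SOME w. w \<in> Q \<and> dot a w = 1)"

lemma affine_vector:
  assumes "Q \<in> pg2_points" "Q \<notin> pg2_line a"
  shows "affine_vector a Q \<in> Q" "dot a (affine_vector a Q) = 1"
proof -
  obtain x where x: "x \<noteq> 0" "Q = vec.span {x}" using assms by (auto simp: pg2_points_eq)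
  then have "dot a x \<noteq> 0" using assms(2) span_in_pg2_line by blast
  then have "inverse (dot a x) *s x \<in> Q \<and> dot a (inverse (dot a x) *s x) = 1"
    using x(2) by (simp add: vec.span_scale vec.span_base)
  then have "affine_vector a Q \<in> Q \<and> dot a (affine_vector a Q) = 1"
    unfolding affine_vector_def by (rule someI)
  then show "affine_vector a Q \<in> Q" "dot a (affine_vector a Q) = 1" by auto
qed

lemma pg2_line_affine_iff:
  assumes "Q \<in> pg2_points" "Q \<notin> pg2_line a"
  shows "Q \<in> pg2_line b \<longleftrightarrow> dot b (affine_vector a Q) = 0"
proof -
  let ?w = "affine_vector a Q"
  have w: "?w \<noteq> 0" using affine_vector(2)[OF assms] by auto
  have "Q = vec.span {?w}"
    using pg2_points_eqI[OF assms(1) span_in_pg2_points[OF w] affine_vector(1)[OF assms] _ w]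
      vec.span_base by blast
  then show ?thesis using span_in_pg2_line[OF w, of b] by simp
qed

text \<open>
  Off the line \<open>pg2_line a\<close>, the lines through \<open>R\<close> are the level sets of
  \<open>dot b\<close>, so the level sizes determine both sums.
\<close>

lemma renitent_line_sum:
  fixes S :: "('a::{field,finite} ^ 3) set set" and a b :: "'a ^ 3" and \<mu> \<tau> :: 'a
  defines "T \<equiv> S - pg2_line a"
  assumes S: "S \<subseteq> pg2_points"
    and ab: "a \<noteq> 0" "b \<noteq> 0" "pg2_line a \<noteq> pg2_line b"
    and R: "R \<in> S" "R \<in> pg2_line a" "R \<in> pg2_line b"
    and \<tau>: "of_nat (card (pg2_line b \<inter> S)) = \<tau>"
    and \<mu>: "\<And>l. l \<in> pg2_lines \<Longrightarrow> R \<in> l \<Longrightarrow> l \<noteq> pg2_line b \<Longrightarrow> of_nat (card (l \<inter> S)) = \<mu>"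
  shows "dot a (\<Sum>Q\<in>T. affine_vector a Q) = \<tau> - \<mu>"
    and "dot b (\<Sum>Q\<in>T. affine_vector a Q) = (\<mu> - 1) * (\<Sum>x\<in>UNIV. x)"
proof -
  define v where "v = (\<lambda>Q. dot b (affine_vector a Q))"
  define N where "N = (\<lambda>c. card {Q \<in> T. v Q = c})"
  have T: "Q \<in> pg2_points" "Q \<notin> pg2_line a" if "Q \<in> T" for Q
    using that S by (auto simp: T_def)
  have level: "Q \<in> pg2_line (b - c *s a) \<longleftrightarrow> v Q = c" if "Q \<in> T" for Q c
    using pg2_line_affine_iff[OF T[OF that]] affine_vector(2)[OF T[OF that]] by (simp add: v_def)
  \<comment> \<open>The point \<open>R\<close> at infinity accounts for the subtracted 1; the
    parameter \<open>c = 0\<close> belongs to \<open>pg2_line b\<close> itself.\<close>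
  have N: "(of_nat (N c) :: 'a) = (if c = 0 then \<tau> else \<mu>) - 1" for c
  proof -
    let ?l = "pg2_line (b - c *s a)"
    have l: "?l \<in> pg2_lines" "?l \<noteq> pg2_line a" "R \<in> ?l"
      using pg2_pencil_in[OF ab] pg2_pencil_mem[OF R(2,3)] by auto
    have "pg2_line a \<in> pg2_lines" using ab by (auto simp: pg2_lines_eq)
    then have "?l \<inter> pg2_line a = {R}"
      using l R pg2_line_unique[of ?l "pg2_line a"] by blast
    then have "?l \<inter> S = insert R {Q \<in> T. v Q = c}"
      using l R level by (auto simp: T_def)
    moreover have "R \<notin> {Q \<in> T. v Q = c}" using R by (auto simp: T_def)
    ultimately have "card (?l \<inter> S) = Suc (N c)" by (simp add: N_def)
    moreover have "of_nat (card (?l \<inter> S)) = (if c = 0 then \<tau> else \<mu>)"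
    proof (cases "c = 0")
      case True
      then show ?thesis using \<tau> by simp
    next
      case False
      have "?l \<noteq> pg2_line b"
      proof
        assume eq: "?l = pg2_line b"
        \<comment> \<open>Up to a scalar this is a member of the pencil with \<open>a\<close> and
          \<open>b\<close> exchanged, and such a member never equals
          \<open>pg2_line b\<close>.\<close>
        have "b - c *s a = (- c) *s (a - inverse c *s b)"
          using False by (simp add: vec_eq_iff field_simps)
        then have "?l = pg2_line (a - inverse c *s b)"
          using False pg2_line_scale[of "- c"] by simp
        then show False using eq pg2_pencil_in(2)[OF ab(2,1), of "inverse c"] ab(3) by simp
      qed
      then show ?thesis using \<mu> l False by simp
    qed
    ultimately show ?thesis by (simp add: algebra_simps)
  qed
  have sum_levels: "(\<Sum>Q\<in>T. f (v Q)) = (\<Sum>c\<in>UNIV. of_nat (N c) * f c)" for f :: "'a \<Rightarrow> 'a"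
  proof -
    have "(\<Sum>Q\<in>T. f (v Q)) = (\<Sum>c\<in>UNIV. \<Sum>Q\<in>{Q \<in> T. v Q = c}. f (v Q))"
      by (rule sum.group[symmetric]) auto
    also have "\<dots> = (\<Sum>c\<in>UNIV. of_nat (N c) * f c)"
      by (intro sum.cong) (auto simp: N_def)
    finally show ?thesis .
  qed
  have "dot a (\<Sum>Q\<in>T. affine_vector a Q) = (\<Sum>Q\<in>T. 1)"
    unfolding dot_sum using affine_vector(2)[OF T] by (intro sum.cong) auto
  also have "\<dots> = (\<Sum>c\<in>UNIV. of_nat (N c))"
    using sum_levels[of "\<lambda>_. 1"] by simp
  \<comment> \<open>The constant part is added \<open>CARD('a)\<close> times and so vanishes in the
    field; only the deviation at \<open>c = 0\<close> survives.\<close>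
  also have "\<dots> = (\<Sum>c\<in>(UNIV :: 'a set). (\<mu> - 1) + (if c = 0 then \<tau> - \<mu> else 0))"
    by (intro sum.cong) (auto simp: N)
  also have "\<dots> = \<tau> - \<mu>"
    by (simp add: sum.distrib of_nat_CARD_eq_0)
  finally show "dot a (\<Sum>Q\<in>T. affine_vector a Q) = \<tau> - \<mu>" .
  have "dot b (\<Sum>Q\<in>T. affine_vector a Q) = (\<Sum>Q\<in>T. v Q)"
    unfolding dot_sum v_def ..
  also have "\<dots> = (\<Sum>c\<in>UNIV. of_nat (N c) * c)"
    by (rule sum_levels)
  \<comment> \<open>The deviating level is weighted by \<open>c = 0\<close>, so
    \<open>\<tau>\<close> disappears here.\<close>
  also have "\<dots> = (\<Sum>c\<in>UNIV. (\<mu> - 1) * c)"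
    by (intro sum.cong) (auto simp: N)
  finally show "dot b (\<Sum>Q\<in>T. affine_vector a Q) = (\<mu> - 1) * (\<Sum>x\<in>UNIV. x)"
    by (simp add: sum_distrib_left)
qed

section \<open>Arcs whose intersection numbers are read in the field\<close>

text \<open>Residues modulo the characteristic become field elements, so that counts can enter
  directly into sums of coordinates.\<close>

locale mod_arc =
  fixes S :: "('a::{field,finite} ^ 3) set set" and \<mu> \<tau> :: 'a
  assumes points: "S \<subseteq> pg2_points"
    and tau_neq_mu: "\<tau> \<noteq> \<mu>"
    and arc: "\<And>R. R \<in> S \<Longrightarrow> \<exists>f\<in>pg2_lines. R \<in> f \<and> of_nat (card (f \<inter> S)) = \<tau> \<and>
      (\<forall>l\<in>pg2_lines. R \<in> l \<and> l \<noteq> f \<longrightarrow> of_nat (card (l \<inter> S)) = \<mu>)"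
begin

text \<open>The nonemptiness condition matters for \<open>\<tau> = 0\<close>, where lines missing
  \<open>S\<close> would also qualify.\<close>

definition tsecants :: "('a ^ 3) set set set" where
  "tsecants = {l \<in> pg2_lines. of_nat (card (l \<inter> S)) = \<tau> \<and> l \<inter> S \<noteq> {}}"

lemma tsecant_ex: "R \<in> S \<Longrightarrow> \<exists>f\<in>tsecants. R \<in> f"
  using arc unfolding tsecants_def by blast

text \<open>Every line through \<open>R\<close> other than the exceptional one has the count
  \<open>\<mu>\<close>, which differs from \<open>\<tau>\<close>.\<close>

lemma tsecant_unique:
  assumes "R \<in> S" "f \<in> tsecants" "R \<in> f" "f' \<in> tsecants" "R \<in> f'"
  shows "f = f'"
proof -
  obtain f0 where f0: "\<And>l. l \<in> pg2_lines \<Longrightarrow> R \<in> l \<Longrightarrow> l \<noteq> f0 \<Longrightarrow> of_nat (card (l \<inter> S)) = \<mu>"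
    using arc[OF assms(1)] by blast
  have "l = f0" if "l \<in> tsecants" "R \<in> l" for l
    using f0[of l] that tau_neq_mu unfolding tsecants_def by auto
  from this[OF assms(2,3)] this[OF assms(4,5)] show ?thesis by simp
qed

lemma msecant:
  assumes "R \<in> S" "f \<in> tsecants" "R \<in> f" "l \<in> pg2_lines" "R \<in> l" "l \<noteq> f"
  shows "of_nat (card (l \<inter> S)) = \<mu>"
proof -
  obtain f0 where f0: "\<And>l. l \<in> pg2_lines \<Longrightarrow> R \<in> l \<Longrightarrow> l \<noteq> f0 \<Longrightarrow> of_nat (card (l \<inter> S)) = \<mu>"
    using arc[OF assms(1)] by blast
  moreover have "f = f0"
    using f0[of f] assms(2,3) tau_neq_mu unfolding tsecants_def by auto
  ultimately show ?thesis using assms by simp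
qed

lemma tsecants_concurrent:
  assumes g: "g \<in> pg2_lines" "of_nat (card (g \<inter> S)) = \<mu>" "3 \<le> card (g \<inter> S)"
  shows "\<exists>Z\<in>pg2_points. \<forall>f\<in>tsecants. f \<inter> g \<inter> S \<noteq> {} \<longrightarrow> Z \<in> f"
proof -
  obtain a where a: "a \<noteq> 0" "g = pg2_line a" using g(1) by (auto simp: pg2_lines_eq)
  \<comment> \<open>Homogeneous coordinates of the centroid: \<open>dot a z\<close> will be the
    number of affine points of \<open>S\<close>, nonzero in the field.\<close>
  define z where "z = (\<Sum>Q\<in>S - pg2_line a. affine_vector a Q)"
  have \<mu>0: "(\<mu> - 1) * (\<Sum>x\<in>UNIV. x) = 0"
  proof (cases "CARD('a) = 2")
    case True
    \<comment> \<open>Three points of \<open>S\<close> fill a line of the plane of order two, so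
      \<open>\<mu>\<close> is 3, which equals 1 in the field.\<close>
    then have "card g \<le> 3" using card_pg2_line_le[OF g(1)] by simp
    moreover have "card (g \<inter> S) \<le> card g" by (intro card_mono) auto
    ultimately have "card (g \<inter> S) = 3" using g(3) by simp
    then have "\<mu> = of_nat CARD('a) + 1" using g(2) True by simp
    then show ?thesis using of_nat_CARD_eq_0[where 'a = 'a] by simp
  next
    case False
    then show ?thesis using sum_finite_field[where 'a = 'a] by simp
  qed
  have *: "dot a z = \<tau> - \<mu> \<and> dot b z = 0"
    if b: "b \<noteq> 0" "pg2_line b \<in> tsecants" "R \<in> pg2_line b" "R \<in> g" "R \<in> S" for b R
  proof -
    have ne: "pg2_line a \<noteq> pg2_line b"
      using g(2) a(2) b(2) tau_neq_mu by (auto simp: tsecants_def)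
    have \<tau>: "of_nat (card (pg2_line b \<inter> S)) = \<tau>" using b(2) by (simp add: tsecants_def)
    have "dot a z = \<tau> - \<mu>" "dot b z = (\<mu> - 1) * (\<Sum>x\<in>UNIV. x)"
      unfolding z_def
      using renitent_line_sum[OF points a(1) b(1) ne b(5) _ b(3) \<tau> msecant[OF b(5,2,3)]] b(4) a(2)
      by auto
    with \<mu>0 show ?thesis by simp
  qed
  have "g \<inter> S \<noteq> {}" using g(3) by auto
  then obtain R f where R: "R \<in> g" "R \<in> S" "f \<in> tsecants" "R \<in> f" using tsecant_ex by blast
  then obtain b where "b \<noteq> 0" "f = pg2_line b" by (auto simp: tsecants_def pg2_lines_eq)
  with R * have "dot a z = \<tau> - \<mu>" by blast
  then have z: "z \<noteq> 0" using tau_neq_mu by auto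
  show ?thesis
  proof (intro bexI ballI impI)
    show "vec.span {z} \<in> pg2_points" using z by (rule span_in_pg2_points)
    fix f assume f: "f \<in> tsecants" "f \<inter> g \<inter> S \<noteq> {}"
    then obtain b where b: "b \<noteq> 0" "f = pg2_line b" by (auto simp: tsecants_def pg2_lines_eq)
    then have "dot b z = 0" using * f by blast
    then show "vec.span {z} \<in> f" using b span_in_pg2_line[OF z] by simp
  qed
qed

text \<open>\<open>U\<close> splits into disjoint blocks of at least \<open>k\<close> points, one
  for each of these secants. Mapping a point of \<open>U\<close> to the parameter of its join with
  \<open>R\<close> embeds \<open>U\<close> into the nonzero field elements.\<close>

lemma card_tsecants_through:
  assumes P: "P \<in> pg2_points" "P \<notin> S" and h: "h \<in> tsecants" "P \<notin> h"
    and k: "\<And>f. f \<in> tsecants \<Longrightarrow> k \<le> card (f \<inter> S)"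
  shows "card {l \<in> tsecants. P \<in> l} * k \<le> CARD('a) - 1"
proof -
  define A where "A = {l \<in> tsecants. P \<in> l}"
  define U where "U = (\<Union>l\<in>A. l \<inter> S)"
  have tl: "f \<in> pg2_lines" if "f \<in> tsecants" for f using that by (simp add: tsecants_def)
  obtain R where R: "R \<in> h" "R \<in> S" using h by (auto simp: tsecants_def)
  obtain j where j: "j \<in> pg2_lines" "P \<in> j" "R \<in> j"
    using pg2_line_join[OF P(1)] R points by blast
  obtain a where a: "a \<noteq> 0" "h = pg2_line a" using tl[OF h(1)] by (auto simp: pg2_lines_eq)
  obtain b where b: "b \<noteq> 0" "j = pg2_line b" using j by (auto simp: pg2_lines_eq)
  have ab: "pg2_line a \<noteq> pg2_line b" using a b j h by auto
  \<comment> \<open>The parameter of the line \<open>RQ\<close> in the pencil at \<open>R\<close>: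
    \<open>h\<close> is at infinity, and \<open>j\<close>, which joins \<open>R\<close> to
    \<open>P\<close>, has parameter 0.\<close>
  define c where "c = (\<lambda>Q. dot b (affine_vector a Q))"
  have U: "\<exists>f\<in>tsecants. P \<in> f \<and> Q \<in> f \<and> R \<notin> f" "Q \<in> pg2_points" "Q \<in> S" "Q \<notin> h" "Q \<notin> j"
    if Q: "Q \<in> U" for Q
  proof -
    obtain f where f: "f \<in> tsecants" "P \<in> f" "Q \<in> f" "Q \<in> S" using Q by (auto simp: U_def A_def)
    moreover have Rf: "R \<notin> f" using tsecant_unique[OF R(2) h(1) R(1) f(1)] f(2) h(2) by blast
    ultimately show "\<exists>f\<in>tsecants. P \<in> f \<and> Q \<in> f \<and> R \<notin> f" by blast
    show "Q \<in> S" "Q \<in> pg2_points" using f points by auto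
    show "Q \<notin> h" using tsecant_unique[OF f(4) h(1) _ f(1) f(3)] f(2) h(2) by blast
    \<comment> \<open>Otherwise \<open>f\<close> and \<open>j\<close> would share \<open>P\<close>
      and \<open>Q\<close>, hence coincide and contain \<open>R\<close>.\<close>
    show "Q \<notin> j"
      using pg2_line_unique[OF tl[OF f(1)] j(1), of P Q] f j P(2) Rf by blast
  qed
  have level: "Q \<in> pg2_line (b - c Q *s a)" if "Q \<in> U" for Q
    using pg2_line_affine_iff[of Q a "b - c Q *s a"] affine_vector(2)[of Q a] U[OF that] a
    by (simp add: c_def)
  have "c ` U \<subseteq> UNIV - {0}"
    using U pg2_line_affine_iff[of _ a b] a b by (auto simp: c_def)
  moreover have "inj_on c U"
  proof (rule inj_onI, rule ccontr)
    fix Q Q' assume Q: "Q \<in> U" and Q': "Q' \<in> U" and "c Q = c Q'" and ne: "Q \<noteq> Q'"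
    define g where "g = pg2_line (b - c Q *s a)"
    have g: "g \<in> pg2_lines" "g \<noteq> h" "R \<in> g" "Q \<in> g" "Q' \<in> g"
      using pg2_pencil_in[OF a(1) b(1) ab] pg2_pencil_mem[of R a b] R j a b
        level[OF Q] level[OF Q'] \<open>c Q = c Q'\<close> by (auto simp: g_def)
    obtain f where f: "f \<in> tsecants" "P \<in> f" "Q \<in> f" "R \<notin> f" using U(1)[OF Q] by blast
    obtain f' where f': "f' \<in> tsecants" "P \<in> f'" "Q' \<in> f'" "R \<notin> f'" using U(1)[OF Q'] by blast
    have "{R, Q, Q'} \<subseteq> g \<inter> S" using g R U(3)[OF Q] U(3)[OF Q'] by blast
    then have "card {R, Q, Q'} \<le> card (g \<inter> S)" by (intro card_mono) auto
    moreover have "R \<noteq> Q" "R \<noteq> Q'" using R U(4) Q Q' by blast+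
    ultimately have "3 \<le> card (g \<inter> S)" using ne by simp
    moreover have "of_nat (card (g \<inter> S)) = \<mu>"
      using msecant[OF R(2) h(1) R(1) g(1,3,2)] .
    ultimately obtain Z where Z: "\<And>f. f \<in> tsecants \<Longrightarrow> f \<inter> g \<inter> S \<noteq> {} \<Longrightarrow> Z \<in> f"
      using tsecants_concurrent[OF g(1)] by blast
    have ZZ: "Z \<in> h" "Z \<in> f" "Z \<in> f'"
      using Z h(1) f(1) f'(1) R g f(3) f'(3) U(3)[OF Q] U(3)[OF Q'] by blast+
    \<comment> \<open>If equal, \<open>f\<close> would be the line \<open>g\<close> through
      \<open>Q\<close> and \<open>Q'\<close>, which contains \<open>R\<close>. So \<open>f\<close>
      and \<open>f'\<close> meet only in \<open>P\<close>, and the common point \<open>Z\<close> is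
      \<open>P\<close>, which is not on \<open>h\<close>.\<close>
    have "f \<noteq> f'"
      using pg2_line_unique[OF tl[OF f(1)] g(1) ne] f f' g by blast
    then have "Z = P"
      using pg2_line_unique[OF tl[OF f(1)] tl[OF f'(1)], of Z P] ZZ f f' by blast
    then show False using ZZ h by blast
  qed
  ultimately have "card U \<le> card (UNIV - {0 :: 'a})"
    by (intro card_inj_on_le) auto
  then have U_le: "card U \<le> CARD('a) - 1" by simp
  have "card U = (\<Sum>l\<in>A. card (l \<inter> S))"
    unfolding U_def
  proof (rule card_UN_disjoint)
    show "\<forall>l\<in>A. \<forall>l'\<in>A. l \<noteq> l' \<longrightarrow> (l \<inter> S) \<inter> (l' \<inter> S) = {}"
      using tsecant_unique by (auto simp: A_def)
  qed auto
  also have "\<dots> \<ge> (\<Sum>l\<in>A. k)"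
    by (intro sum_mono k) (auto simp: A_def)
  finally show ?thesis using U_le by (simp add: A_def)
qed

text \<open>Sending each point of \<open>g \<inter> S\<close> to its secant in
  \<open>tsecants\<close> is injective, so a common point of these secants outside \<open>S\<close>
  transfers the previous bound. How it is found depends on the size of
  \<open>g \<inter> S\<close>.\<close>

lemma card_msecant:
  assumes nc: "\<And>P. P \<in> pg2_points \<Longrightarrow> \<exists>h\<in>tsecants. P \<notin> h"
    and g: "g \<in> pg2_lines" "of_nat (card (g \<inter> S)) = \<mu>"
    and k: "\<And>f. f \<in> tsecants \<Longrightarrow> k \<le> card (f \<inter> S)"
  shows "card (g \<inter> S) * k \<le> CARD('a) - 1"
proof -
  have tl: "f \<in> pg2_lines" if "f \<in> tsecants" for f using that by (simp add: tsecants_def)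
  have gt: "g \<notin> tsecants" using g tau_neq_mu by (auto simp: tsecants_def)
  obtain F where F: "\<And>R. R \<in> S \<Longrightarrow> F R \<in> tsecants \<and> R \<in> F R" using tsecant_ex by metis
  have inj: "inj_on F (g \<inter> S)"
  proof (rule inj_onI, rule ccontr)
    fix R R' assume *: "R \<in> g \<inter> S" "R' \<in> g \<inter> S" "F R = F R'" "R \<noteq> R'"
    then have "F R = g"
      using pg2_line_unique[OF tl g(1), of "F R" R R'] F[of R] F[of R'] by auto
    then show False using * F[of R] gt by auto
  qed
  have bound: "card (g \<inter> S) * k \<le> CARD('a) - 1"
    if Z: "Z \<in> pg2_points" "Z \<notin> S" "\<And>R. R \<in> g \<inter> S \<Longrightarrow> Z \<in> F R" for Z
  proof -
    obtain h where "h \<in> tsecants" "Z \<notin> h" using nc Z(1) by blast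
    then have "card {l \<in> tsecants. Z \<in> l} * k \<le> CARD('a) - 1"
      using card_tsecants_through[OF Z(1,2)] k by blast
    moreover have "card (g \<inter> S) \<le> card {l \<in> tsecants. Z \<in> l}"
      using inj F Z(3) by (intro card_inj_on_le[of F]) auto
    ultimately show ?thesis using mult_le_mono1 order_trans by blast
  qed
  consider "card (g \<inter> S) = 0" | "card (g \<inter> S) = 1" | "2 \<le> card (g \<inter> S)" by linarith
  then show ?thesis
  proof cases
    case 1
    then show ?thesis by simp
  next
    case 2
    then obtain R where R: "g \<inter> S = {R}" by (meson card_1_singletonE)
    then have RS: "R \<in> S" by blast
    \<comment> \<open>A single secant leaves \<open>Z\<close> free; it is placed on a second one,
      since distinct members of \<open>tsecants\<close> never meet in \<open>S\<close>.\<close>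
    then obtain h where h: "h \<in> tsecants" "R \<notin> h" using nc points by blast
    obtain Z where Z: "Z \<in> pg2_points" "Z \<in> h" "Z \<in> F R"
      using pg2_lines_meet[OF tl tl] h(1) F[OF RS] by blast
    have "Z \<notin> S"
      using tsecant_unique[of Z h "F R"] Z h F[OF RS] by blast
    then show ?thesis using bound[OF Z(1)] Z(3) R by simp
  next
    case 3
    then obtain R R' where RR: "R \<in> g \<inter> S" "R' \<in> g \<inter> S" "R \<noteq> R'"
      by (metis card_le_Suc0_iff_eq finite not_less_eq_eq numeral_2_eq_2)
    have "\<exists>Z\<in>pg2_points. \<forall>R\<in>g \<inter> S. Z \<in> F R"
    proof (cases "card (g \<inter> S) = 2")
      case True
      then have "g \<inter> S = {R, R'}"
        using RR by (intro card_seteq[symmetric]) auto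
      moreover obtain Z where "Z \<in> pg2_points" "Z \<in> F R" "Z \<in> F R'"
        using pg2_lines_meet[OF tl tl] RR F by blast
      ultimately show ?thesis by (intro bexI[of _ Z]) auto
    next
      case False
      then have "3 \<le> card (g \<inter> S)" using 3 by simp
      from tsecants_concurrent[OF g this] obtain Z where "Z \<in> pg2_points"
        and Z: "\<And>f. f \<in> tsecants \<Longrightarrow> f \<inter> g \<inter> S \<noteq> {} \<Longrightarrow> Z \<in> f" by blast
      moreover have "Z \<in> F R" if "R \<in> g \<inter> S" for R
        using Z[of "F R"] F[of R] that by blast
      ultimately show ?thesis by (intro bexI[of _ Z]) auto
    qed
    then obtain Z where Z: "Z \<in> pg2_points" "\<And>R. R \<in> g \<inter> S \<Longrightarrow> Z \<in> F R" by blast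
    \<comment> \<open>\<open>F R\<close> and \<open>F R'\<close> are distinct by injectivity, and a
      point of \<open>S\<close> lies on only one of \<open>tsecants\<close>.\<close>
    have "Z \<notin> S"
      using tsecant_unique[of Z "F R" "F R'"] RR F Z(2) inj by (auto dest: inj_onD)
    then show ?thesis using bound Z by blast
  qed
qed

end

section \<open>Transfer from congruences modulo \<open>p\<close> to the field, and the final
  bounds\<close>

theorem theorem5p6:
  fixes p n q m t t' m' :: nat
    and S :: "(('a::{field,finite}) ^ 3) set set"
  assumes "prime p"
    and "q = p ^ n"
    and "CARD('a) = q"
    and "mod_generalized_KM_arc pg2_points pg2_lines p m t S"
    and "t \<noteq> m"
    and "\<not> concurrent pg2_points (proper_mod_secants pg2_lines S p t)"
    and "t' = Min ((\<lambda>l. card (l \<inter> S)) ` proper_mod_secants pg2_lines S p t)"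
    and "m' = Min ((\<lambda>l. card (l \<inter> S)) ` proper_mod_secants pg2_lines S p m)"
  shows "(\<forall>P \<in> pg2_points - S.
            real (card {l \<in> proper_mod_secants pg2_lines S p t. P \<in> l})
              \<le> (real q - 1) / real t') \<and>
         (\<forall>l \<in> mod_secants pg2_lines S p m.
            real (card (l \<inter> S)) \<le> (real q - 1) / real t')"
proof -
  have CHAR: "CHAR('a) = p" using CHAR_finite_field assms(1-3) by blast
  have cong: "[x = y] (mod p) \<longleftrightarrow> (of_nat x :: 'a) = of_nat y" for x y
    by (simp add: of_nat_eq_iff_cong_CHAR CHAR)
  have KM: "m \<le> p - 1" "t \<le> p - 1" "S \<subset> pg2_points" "S \<noteq> {}"
    "\<And>R. R \<in> S \<Longrightarrow> \<exists>l\<in>mod_secants pg2_lines S p t. R \<in> l \<and>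
        (\<forall>l'\<in>pg2_lines. R \<in> l' \<and> l' \<noteq> l \<longrightarrow> l' \<in> mod_secants pg2_lines S p m)"
    using assms(4) by (auto simp: mod_generalized_KM_arc_def)
  have "p > 0" using assms(1) prime_gt_0_nat by blast
  then have "m < p" "t < p" using KM(1,2) by auto
  then have "\<not> [t = m] (mod p)" using assms(5) cong_less_modulus_unique_nat by blast
  then have ne: "(of_nat t :: 'a) \<noteq> of_nat m" using cong by blast
  interpret mod_arc S "of_nat m :: 'a" "of_nat t"
  proof
    show "S \<subseteq> pg2_points" using KM(3) by blast
    show "(of_nat t :: 'a) \<noteq> of_nat m" by (fact ne)
    show "\<exists>f\<in>pg2_lines. R \<in> f \<and> (of_nat (card (f \<inter> S)) :: 'a) = of_nat t \<and>
      (\<forall>l\<in>pg2_lines. R \<in> l \<and> l \<noteq> f \<longrightarrow> (of_nat (card (l \<inter> S)) :: 'a) = of_nat m)"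
      if "R \<in> S" for R
      using KM(5)[OF that] unfolding mod_secants_def cong by blast
  qed
  have ts: "proper_mod_secants pg2_lines S p t = tsecants"
    unfolding proper_mod_secants_def mod_secants_def tsecants_def cong by blast
  have nc: "\<exists>h\<in>tsecants. P \<notin> h" if "P \<in> pg2_points" for P
    using assms(6) that unfolding concurrent_def ts by blast
  have t'_le: "t' \<le> card (f \<inter> S)" if "f \<in> tsecants" for f
    unfolding assms(7) ts using that by (intro Min_le) auto
  have "tsecants \<noteq> {}" using KM(4) tsecant_ex by blast
  then have "t' \<in> (\<lambda>l. card (l \<inter> S)) ` tsecants"
    unfolding assms(7) ts by (intro Min_in) auto
  \<comment> \<open>Proper secants meet \<open>S\<close>, so the minimum is positive and the
    division by \<open>t'\<close> is genuine.\<close>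
  then have t'_pos: "t' > 0" by (auto simp: tsecants_def card_gt_0_iff)
  have real_bound: "real x \<le> (real q - 1) / real t'" if "x * t' \<le> CARD('a) - 1" for x
  proof -
    have "real (x * t') \<le> real (CARD('a) - 1)" using that by (simp only: of_nat_le_iff)
    also have "\<dots> = real q - 1" using assms(3) zero_less_card_finite[where 'a = 'a]
      by (simp add: of_nat_diff Suc_leI)
    finally show ?thesis using t'_pos by (simp add: pos_le_divide_eq)
  qed
  show ?thesis
  proof (intro conjI ballI)
    fix P :: "('a ^ 3) set" assume "P \<in> pg2_points - S"
    moreover from this obtain h where "h \<in> tsecants" "P \<notin> h" using nc by blast
    ultimately show "real (card {l \<in> proper_mod_secants pg2_lines S p t. P \<in> l})
        \<le> (real q - 1) / real t'"
      unfolding ts using t'_le by (intro real_bound card_tsecants_through) auto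
  next
    fix l assume "l \<in> mod_secants pg2_lines S p m"
    then have "l \<in> pg2_lines" "(of_nat (card (l \<inter> S)) :: 'a) = of_nat m"
      unfolding mod_secants_def cong by auto
    then show "real (card (l \<inter> S)) \<le> (real q - 1) / real t'"
      using nc t'_le by (intro real_bound card_msecant) auto
  qed
qed

end
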